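(* Let $n,m>0$, let $\phi:\mathbb R^n\times\mathbb R^m\to\mathbb R$ be a convex function and let $F:\mathbb R^m\rightrightarrows\mathbb R^n$ be a closed convex set-valued mapping. Let $F_\phi$ be the feasible cost space mapping and $v:\mathbb R^m\to\overline{\mathbb R}$ the optimal value function of $\min_x \phi(x,y)$ subject to $x\in F(y)$, both as defined in the context. Let $Y\subset\mathbb R^m$ be a non-empty, open, convex subset of $\operatorname{dom}F$, and let $F_\phi$ be closed and locally bounded from below on $Y$ (that is, at every point of $Y$). Then $Y\subset\operatorname{dom}v$ and $v$ is a proper convex function on $Y$.
   Context: A set-valued mapping is convex (resp. closed) if its graph is convex (resp. closed); $\operatorname{gph}F=\{(x,y)\in\mathbb R^{n+m} : x\in F(y)\}$. The convex function $\phi$ has closed convex epigraph $\operatorname{epi}\phi=\{(x,y,\mu)\in\mathbb R^{n+m+1} : \mu\ge\phi(x,y)\}$. The feasible cost space mapping $F_\phi:\mathbb R^m\rightrightarrows\mathbb R$ is $F_\phi(y)=\{\mu\in\mathbb R : \exists x\in F(y),\ \mu\ge\phi(x,y)\}$, with $\operatorname{gph}F_\phi=\{(y,\mu)\in\mathbb R^m\times\mathbb R : \mu\in F_\phi(y)\}$. The domain of a set-valued mapping is the set of points where its value is non-empty. The optimal value function $v:\mathbb R^m\to\overline{\mathbb R}=\mathbb R\cup\{\pm\infty\}$ is $v(y)=\min\{\phi(x,y) : x\in F(y)\}$ if this minimum is attained; $v(y)=+\infty$ if $F(y)=\emptyset$; and $v(y)=-\infty$ if $F(y)\ne\emptyset$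 but $\phi(\cdot,y)$ does not have a minimum on $F(y)$. Its domain is $\operatorname{dom}v=\{y : v(y)<+\infty\}$. The function $v$ is proper on $Y$ if it has non-empty domain and $v(y)>-\infty$ for all $y\in Y$. A set-valued mapping $f:\mathbb R^m\rightrightarrows\mathbb R$ is locally bounded from below at $y_0\in\operatorname{dom}f$ if there exist a constant $c\in\mathbb R$ and an open neighbourhood $A\subset\mathbb R^m$ of $y_0$ such that $c\le\mu$ for all $\mu\in f(A)=\bigcup_{y\in A}f(y)$. *)

theory Defs
  imports "HOL-Analysis.Analysis"
begin

(* A set-valued mapping from 'b to subsets of 'a is a function 'b => 'a set. Its graph is taken
   in the order (argument, value). Listing the value first, as is also customary, changes the
   graph only by the coordinate swap, a linear homeomorphism, so closedness and convexity of the
   graph do not depend on the order. *)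
definition gph :: "('b \<Rightarrow> 'a set) \<Rightarrow> ('b \<times> 'a) set" where
  "gph F = {(y, x). x \<in> F y}"

definition set_dom :: "('b \<Rightarrow> 'a set) \<Rightarrow> 'b set" where
  "set_dom F = {y. F y \<noteq> {}}"

definition closed_mapping ::
    "('b::topological_space \<Rightarrow> 'a::topological_space set) \<Rightarrow> bool" where
  "closed_mapping F \<longleftrightarrow> closed (gph F)"

definition convex_mapping ::
    "('b::real_vector \<Rightarrow> 'a::real_vector set) \<Rightarrow> bool" where
  "convex_mapping F \<longleftrightarrow> convex (gph F)"

definition feasible_cost ::
    "('a \<times> 'b \<Rightarrow> real) \<Rightarrow> ('b \<Rightarrow> 'a set) \<Rightarrow> 'b \<Rightarrow> real set" where
  "feasible_cost \<phi> F y = {\<mu>. \<exists>x\<in>F y. \<mu> \<ge> \<phi> (x, y)}"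

definition locally_bdd_below_at :: "('b::topological_space \<Rightarrow> real set) \<Rightarrow> 'b \<Rightarrow> bool" where
  "locally_bdd_below_at f y0 \<longleftrightarrow>
     y0 \<in> set_dom f \<and>
     (\<exists>c A. open A \<and> y0 \<in> A \<and> (\<forall>\<mu>\<in>(\<Union>y\<in>A. f y). c \<le> \<mu>))"

(* The value -\<infinity> means "feasible, but the minimum is not attained"; in particular it is also the
   value when the infimum is finite but not attained, so this is not the infimum function. *)
definition optimal_value ::
    "('a \<times> 'b \<Rightarrow> real) \<Rightarrow> ('b \<Rightarrow> 'a set) \<Rightarrow> 'b \<Rightarrow> ereal" where
  "optimal_value \<phi> F y =
     (if F y = {} then \<infinity>
      else if \<exists>x. is_arg_min (\<lambda>x. \<phi> (x, y)) (\<lambda>x. x \<in> F y) x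
        then ereal (\<phi> (arg_min_on (\<lambda>x. \<phi> (x, y)) (F y), y))
      else - \<infinity>)"

definition eff_dom :: "('b \<Rightarrow> ereal) \<Rightarrow> 'b set" where
  "eff_dom v = {y. v y < \<infinity>}"

definition proper_on :: "'b set \<Rightarrow> ('b \<Rightarrow> ereal) \<Rightarrow> bool" where
  "proper_on Y v \<longleftrightarrow> eff_dom v \<noteq> {} \<and> (\<forall>y\<in>Y. v y > - \<infinity>)"

(* The library's convex_on covers real-valued functions only. Convexity of an extended-real-valued
   function is convexity of its epigraph, whose points have finite last coordinate. This avoids
   \<infinity> - \<infinity>. *)
definition epigraph_on :: "'b set \<Rightarrow> ('b \<Rightarrow> ereal) \<Rightarrow> ('b \<times> real) set" where
  "epigraph_on Y v = {(y, \<mu>). y \<in> Y \<and> v y \<le> ereal \<mu>}"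

definition ereal_convex_on :: "'b::real_vector set \<Rightarrow> ('b \<Rightarrow> ereal) \<Rightarrow> bool" where
  "ereal_convex_on Y v \<longleftrightarrow> convex Y \<and> convex (epigraph_on Y v)"

end

theory Submission
  imports Defs
begin

text \<open>
  The idea is to work with the sets of reals \<open>F\<^sub>\<phi>(y)\<close> in place of the
  minimisation problems. Each of them is upward closed, and it contains its infimum exactly
  when \<open>\<phi>(\<cdot>, y)\<close> attains its minimum on \<open>F(y)\<close>: a cost in the set dominates a feasible value,
  which again lies in the set, so the smallest cost must itself be such a value.

  Closedness of the graph makes every \<open>F\<^sub>\<phi>(y)\<close> closed, and local boundedness from below
  at \<open>y\<close> bounds it from below. Hence over \<open>Y\<close> the infimum is always attained, the optimal value
  \<open>v\<close> is finite, and the epigraph of \<open>v\<close> over \<open>Y\<close> is the part of the graph of \<open>F\<^sub>\<phi>\<close> that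
  lies above \<open>Y\<close>. That graph is the image of the convex set \<open>epi \<phi> \<inter> (gph F \<times> \<real>)\<close> under
  the projection that forgets \<open>x\<close>, so it is convex.
\<close>

text \<open>
  The definition of the optimal value picks an arbitrary minimiser; all minimisers have the same
  cost, so any one of them may be used to compute it.
\<close>

lemma optimal_value_eq_minimum:
  assumes "is_arg_min (\<lambda>x. \<phi> (x, y)) (\<lambda>x. x \<in> F y) x"
  shows "optimal_value \<phi> F y = ereal (\<phi> (x, y))"
proof -
  let ?a = "arg_min_on (\<lambda>x. \<phi> (x, y)) (F y)"
  have "is_arg_min (\<lambda>x. \<phi> (x, y)) (\<lambda>x. x \<in> F y) ?a"
    unfolding arg_min_on_def arg_min_def using assms by (rule someI)
  then have "\<phi> (?a, y) = \<phi> (x, y)"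
    using assms by (auto simp: is_arg_min_linorder intro: antisym)
  moreover have "F y \<noteq> {}"
    using assms by (auto simp: is_arg_min_def)
  ultimately show ?thesis
    using assms by (auto simp: optimal_value_def)
qed

lemma feasible_cost_eq_atLeast_minimum:
  assumes "is_arg_min (\<lambda>x. \<phi> (x, y)) (\<lambda>x. x \<in> F y) x"
  shows "feasible_cost \<phi> F y = {\<phi> (x, y)..}"
  using assms by (force simp: feasible_cost_def is_arg_min_linorder)

text \<open>
  The infimum of the feasible costs lies in the closed set, so some feasible \<open>x\<close> costs at most
  the infimum. Every feasible value is itself a feasible cost, hence nothing is cheaper than \<open>x\<close>.
\<close>

lemma minimiser_if_feasible_cost_closed:
  assumes closed: "closed (feasible_cost \<phi> F y)"
    and bdd: "bdd_below (feasible_cost \<phi> F y)"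
    and ne: "F y \<noteq> {}"
  obtains x where "is_arg_min (\<lambda>x. \<phi> (x, y)) (\<lambda>x. x \<in> F y) x"
proof -
  have feasible: "\<phi> (x, y) \<in> feasible_cost \<phi> F y" if "x \<in> F y" for x
    using that by (auto simp: feasible_cost_def)
  then have "Inf (feasible_cost \<phi> F y) \<in> feasible_cost \<phi> F y"
    using closed bdd ne by (intro closed_contains_Inf) auto
  then obtain x where x: "x \<in> F y" "\<phi> (x, y) \<le> Inf (feasible_cost \<phi> F y)"
    by (auto simp: feasible_cost_def)
  have "\<phi> (x, y) \<le> \<phi> (z, y)" if "z \<in> F y" for z
    using x(2) cInf_lower[OF feasible[OF that] bdd] by linarith
  with x(1) show thesis
    by (intro that) (auto simp: is_arg_min_linorder)
qed

lemma closed_mapping_imp_closed_value: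
  assumes "closed_mapping f"
  shows "closed (f y)"
proof -
  have "closed (Pair y -` gph f)"
    using assms unfolding closed_mapping_def
    by (intro closed_vimage continuous_intros)
  then show ?thesis
    by (simp add: gph_def vimage_def)
qed

lemma locally_bdd_below_at_imp_bdd_below:
  assumes "locally_bdd_below_at f y"
  shows "bdd_below (f y)"
  using assms unfolding locally_bdd_below_at_def bdd_below_def by blast

text \<open>
  Convexity of the graph of \<open>F\<close> makes a combination of feasible points feasible for the combined
  parameter. Bounding its cost then takes convexity of \<open>\<phi>\<close> in both arguments jointly, since \<open>x\<close> and
  \<open>y\<close> move together.
\<close>

lemma convex_mapping_feasible_cost:
  assumes \<phi>: "convex_on UNIV \<phi>" and F: "convex_mapping F"
  shows "convex_mapping (feasible_cost \<phi> F)"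
  unfolding convex_mapping_def
proof (rule convexI)
  fix p q :: "'b \<times> real" and s t :: real
  assume p: "p \<in> gph (feasible_cost \<phi> F)" and q: "q \<in> gph (feasible_cost \<phi> F)"
    and st: "0 \<le> s" "0 \<le> t" "s + t = 1"
  from p obtain y \<mu> x where p_eq: "p = (y, \<mu>)" and x: "x \<in> F y" "\<phi> (x, y) \<le> \<mu>"
    by (auto simp: gph_def feasible_cost_def)
  from q obtain z \<nu> w where q_eq: "q = (z, \<nu>)" and w: "w \<in> F z" "\<phi> (w, z) \<le> \<nu>"
    by (auto simp: gph_def feasible_cost_def)
  have "s *\<^sub>R (y, x) + t *\<^sub>R (z, w) \<in> gph F"
    using F x(1) w(1) st unfolding convex_mapping_def by (intro convexD) (auto simp: gph_def)
  then have "s *\<^sub>R x + t *\<^sub>R w \<in> F (s *\<^sub>R y + t *\<^sub>R z)"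
    by (simp add: gph_def)
  moreover have "\<phi> (s *\<^sub>R x + t *\<^sub>R w, s *\<^sub>R y + t *\<^sub>R z) \<le> s * \<mu> + t * \<nu>"
  proof -
    have "\<phi> (s *\<^sub>R (x, y) + t *\<^sub>R (w, z)) \<le> s * \<phi> (x, y) + t * \<phi> (w, z)"
      using \<phi> st unfolding convex_on_def by blast
    also have "\<dots> \<le> s * \<mu> + t * \<nu>"
      using x(2) w(2) st by (intro add_mono mult_left_mono)
    finally show ?thesis by simp
  qed
  ultimately show "s *\<^sub>R p + t *\<^sub>R q \<in> gph (feasible_cost \<phi> F)"
    by (auto simp: p_eq q_eq gph_def feasible_cost_def)
qed

theorem theorem5:
  fixes \<phi> :: "(real ^ 'n) \<times> (real ^ 'm) \<Rightarrow> real"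
    and F :: "real ^ 'm \<Rightarrow> (real ^ 'n) set"
    and Y :: "(real ^ 'm) set"
  assumes "convex_on UNIV \<phi>"
    and "closed_mapping F" and "convex_mapping F"
    and "Y \<noteq> {}" and "open Y" and "convex Y" and "Y \<subseteq> set_dom F"
    and "closed_mapping (feasible_cost \<phi> F)"
    and "\<forall>y\<in>Y. locally_bdd_below_at (feasible_cost \<phi> F) y"
  shows "Y \<subseteq> eff_dom (optimal_value \<phi> F)
    \<and> proper_on Y (optimal_value \<phi> F)
    \<and> ereal_convex_on Y (optimal_value \<phi> F)"
proof -
  let ?v = "optimal_value \<phi> F"
  have "\<exists>m. ?v y = ereal m \<and> feasible_cost \<phi> F y = {m..}" if y: "y \<in> Y" for y
  proof -
    have "closed (feasible_cost \<phi> F y)"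
      by (rule closed_mapping_imp_closed_value) fact
    moreover have "bdd_below (feasible_cost \<phi> F y)"
      using assms(9) y by (intro locally_bdd_below_at_imp_bdd_below) simp
    moreover have "F y \<noteq> {}"
      using assms(7) y by (auto simp: set_dom_def)
    ultimately obtain x where x: "is_arg_min (\<lambda>x. \<phi> (x, y)) (\<lambda>x. x \<in> F y) x"
      by (rule minimiser_if_feasible_cost_closed)
    show ?thesis
      using optimal_value_eq_minimum[of \<phi> y F x, OF x]
        feasible_cost_eq_atLeast_minimum[of \<phi> y F x, OF x]
      by (intro exI conjI)
  qed
  then obtain m where
    v: "\<And>y. y \<in> Y \<Longrightarrow> ?v y = ereal (m y)" and
    cost: "\<And>y. y \<in> Y \<Longrightarrow> feasible_cost \<phi> F y = {m y..}"
    by metis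
  have dom: "Y \<subseteq> eff_dom ?v"
    by (auto simp: eff_dom_def v)
  moreover have "proper_on Y ?v"
    using dom \<open>Y \<noteq> {}\<close> by (auto simp: proper_on_def v)
  moreover have "ereal_convex_on Y ?v"
  proof -
    have "epigraph_on Y ?v = gph (feasible_cost \<phi> F) \<inter> Y \<times> UNIV"
      by (auto simp: epigraph_on_def gph_def v cost)
    moreover have "convex (gph (feasible_cost \<phi> F))"
      using convex_mapping_feasible_cost[OF assms(1,3)] by (simp add: convex_mapping_def)
    ultimately show ?thesis
      using \<open>convex Y\<close> by (simp add: ereal_convex_on_def convex_Int convex_Times)
  qed
  ultimately show ?thesis by blast
qed

end
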